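(* Let $q\ge1$ and let $A=(a_1,\ldots,a_q)$, $B=(b_1,\ldots,b_q)$ be real vectors such that $B\prec^W A$ but not $B\prec A$ (that is, $\psi=\sum_{i=1}^{q}(b_i-a_i)>0$). Then for all $0<s<1$ $$ G^{q,0}_{q,q}\left(s\,\Big|\begin{array}{c}B\\ A\end{array}\right)\ge 0. $$
   Context: $B\prec^W A$ ($B$ is weakly supermajorized by $A$) means: $0<a_1\le a_2\le\cdots\le a_q$, $0<b_1\le b_2\le\cdots\le b_q$, and $\sum_{i=1}^{k}a_i\le\sum_{i=1}^{k}b_i$ for $k=1,\ldots,q$. If in addition $\sum_{i=1}^{q}(b_i-a_i)=0$, one writes $B\prec A$ ($B$ is majorized by $A$). Meijer's function is $$G^{q,0}_{q,q}\left(x\,\Big|\begin{array}{c}B\\ A\end{array}\right)=\frac{1}{2\pi i}\int_{c-i\infty}^{c+i\infty}\frac{\Gamma(a_1+s)\cdots\Gamma(a_q+s)}{\Gamma(b_1+s)\cdots\Gamma(b_q+s)}x^{-s}\,ds,\qquad c>-\min(a_1,\ldots,a_q),$$ for $x>0$, the integral being understood as $\lim_{R\to\infty}\int_{c-iR}^{c+iR}$. *)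

theory Defs
  imports "HOL-Complex_Analysis.Complex_Analysis"
begin

text \<open>
  A vector of length \<open>q\<close> is a function on \<open>nat\<close>, of which only the entries with index in
  \<open>{1..q}\<close> matter. In both relations below the first vector is the (weakly super)majorized one.
\<close>

definition weakly_supermajorized :: "nat \<Rightarrow> (nat \<Rightarrow> real) \<Rightarrow> (nat \<Rightarrow> real) \<Rightarrow> bool" where
  "weakly_supermajorized q b a \<longleftrightarrow>
     (\<forall>i\<in>{1..q}. 0 < a i) \<and> mono_on {1..q} a \<and>
     (\<forall>i\<in>{1..q}. 0 < b i) \<and> mono_on {1..q} b \<and>
     (\<forall>k\<in>{1..q}. (\<Sum>i=1..k. a i) \<le> (\<Sum>i=1..k. b i))"

definition majorized :: "nat \<Rightarrow> (nat \<Rightarrow> real) \<Rightarrow> (nat \<Rightarrow> real) \<Rightarrow> bool" where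
  "majorized q b a \<longleftrightarrow>
     weakly_supermajorized q b a \<and> (\<Sum>i=1..q. b i - a i) = 0"

definition meijer_integrand :: "nat \<Rightarrow> (nat \<Rightarrow> real) \<Rightarrow> (nat \<Rightarrow> real) \<Rightarrow> real \<Rightarrow> complex \<Rightarrow> complex" where
  "meijer_integrand q b a x s =
     (\<Prod>i=1..q. Gamma (of_real (a i) + s)) / (\<Prod>i=1..q. Gamma (of_real (b i) + s))
       * of_real x powr (- s)"

text \<open>
  \<open>has_meijer_G q b a x g\<close> says that the integral defining
  \<open>G\<close> with upper row \<open>b\<close> and lower row \<open>a\<close> converges at \<open>x\<close>, as a symmetric improper integral,
  to the same value \<open>g\<close> for every admissible abscissa \<open>c\<close>.
\<close>

definition has_meijer_G ::
  "nat \<Rightarrow> (nat \<Rightarrow> real) \<Rightarrow> (nat \<Rightarrow> real) \<Rightarrow> real \<Rightarrow> complex \<Rightarrow> bool" where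
  "has_meijer_G q b a x g \<longleftrightarrow>
     (\<forall>c. c > - Min (a ` {1..q}) \<longrightarrow>
        ((\<lambda>R. 1 / (2 * of_real pi * \<i>) *
              contour_integral (linepath (Complex c (- R)) (Complex c R)) (meijer_integrand q b a x))
           \<longlongrightarrow> g) at_top)"

text \<open>
  The value is meaningful only where such a \<open>g\<close> exists; it is then unique.
\<close>

definition meijer_G :: "nat \<Rightarrow> (nat \<Rightarrow> real) \<Rightarrow> (nat \<Rightarrow> real) \<Rightarrow> real \<Rightarrow> complex" where
  "meijer_G q b a x = (THE g. has_meijer_G q b a x g)"

end

(*
  Call f a positive multiplier if multiplying by f preserves nonnegativity of the Fourier
  transform on every interval [-R, R]. Such functions are closed under sums, products and limits,
  contain t |-> 1 / (a + it), and are bounded in modulus by their value at 0. Weak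
  supermajorization makes every factor prod_i (b_i + k + it) / (a_i + k + it) a positive multiplier:
  along the segment from a to b it is a product of small steps, each of which is a combination of
  such reciprocals with nonnegative coefficients. By Euler's product, so is the Gamma ratio
  F(c + it) for every admissible c.

  Decay: raising a_q by 1/n keeps the supermajorization if 1/n <= psi, and F changes by the factor
  Gamma(a_q + s) / Gamma(a_q + 1/n + s), which is O(|t|^(-1/n)).

  Convergence: the functional equation of Gamma expresses x^(-s) F(s) - x * x^(-s-1) F(s + 1) as
  x^(-s) F(s) * O(1 / |s|), which is absolutely integrable on vertical lines, while shifting the line
  by 1 costs o(1). Hence (1 - x) times the integral converges.

  Sign: the Fejer kernel has a nonnegative Fourier transform, so the Cesaro means of the integral
  on Re s = 0 are nonnegative.
*)
theory Submission imports Defs begin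

section \<open>Positive multipliers and their closure properties\<close>

text \<open>A bounded interval suits functions that decay too slowly to be absolutely integrable on
  the whole line; continuity makes every integral exist. Membership in the nonnegative reals, for a
  complex number, also asserts that it is real.\<close>

definition fourier_nonneg :: "real \<Rightarrow> (real \<Rightarrow> complex) \<Rightarrow> bool" where
  "fourier_nonneg R h \<longleftrightarrow> continuous_on {-R..R} h \<and>
     (\<forall>y. integral {-R..R} (\<lambda>t. h t * cis (- (y * t))) \<in> \<real>\<^sub>\<ge>\<^sub>0)"

text \<open>The model case is the Fourier transform of a finite positive measure: multiplying by it
  convolves the transform of \<open>h\<close> with that measure. The bound by the value at 0
  supplies the majorant for passing to limits and, later, the estimates of Gamma ratios.\<close>

definition positive_multiplier :: "(real \<Rightarrow> complex) \<Rightarrow> bool" where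
  "positive_multiplier f \<longleftrightarrow> continuous_on UNIV f \<and> (\<forall>t. norm (f t) \<le> Re (f 0)) \<and>
     (\<forall>R h. fourier_nonneg R h \<longrightarrow> fourier_nonneg R (\<lambda>t. f t * h t))"

lemma fourier_nonneg_integrable:
  assumes "fourier_nonneg R h"
  shows "(\<lambda>t. h t * cis (- (y * t))) integrable_on {-R..R}"
  using assms by (auto simp: fourier_nonneg_def intro!: integrable_continuous_real continuous_intros)

lemma positive_multiplierD:
  assumes "positive_multiplier f"
  shows "continuous_on A f" "norm (f t) \<le> Re (f 0)"
    "fourier_nonneg R h \<Longrightarrow> fourier_nonneg R (\<lambda>t. f t * h t)"
  using assms continuous_on_subset by (auto simp: positive_multiplier_def)

text \<open>The bound at \<open>t = 0\<close> leaves no room for an imaginary part. Hence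
  \<open>Re (f 0 * g 0)\<close> factors, which the bound for products requires.\<close>

lemma positive_multiplier_at_0:
  assumes "positive_multiplier f"
  shows "f 0 = of_real (Re (f 0))"
proof -
  have "Re (f 0) \<ge> 0" "norm (f 0) \<le> Re (f 0)"
    using positive_multiplierD(2)[OF assms, of 0] norm_ge_zero order_trans by blast+
  then have "Im (f 0) = 0"
    using cmod_power2[of "f 0"] power_mono[of "norm (f 0)" "Re (f 0)" 2] by simp
  then show ?thesis by (simp add: complex_eq_iff)
qed

lemma positive_multiplier_cmult:
  assumes "c \<ge> 0" "positive_multiplier f"
  shows "positive_multiplier (\<lambda>t. of_real c * f t)"
  unfolding positive_multiplier_def
proof (intro conjI allI impI)
  show "continuous_on UNIV (\<lambda>t. of_real c * f t)"
    by (intro continuous_intros positive_multiplierD assms)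
  show "norm (of_real c * f t) \<le> Re (of_real c * f 0)" for t
    using assms positive_multiplierD(2)[OF assms(2), of t] by (simp add: norm_mult mult_left_mono)
  show "fourier_nonneg R (\<lambda>t. of_real c * f t * h t)" if "fourier_nonneg R h" for R h
  proof -
    have "fourier_nonneg R (\<lambda>t. f t * h t)" by (rule positive_multiplierD) fact+
    moreover have "integral {-R..R} (\<lambda>t. of_real c * f t * h t * cis (- (y * t)))
        = of_real c * integral {-R..R} (\<lambda>t. f t * h t * cis (- (y * t)))" for y
      by (simp add: mult.assoc flip: integral_mult_right)
    ultimately show ?thesis using assms
      by (auto simp: fourier_nonneg_def mult.assoc intro!: continuous_intros nonneg_Reals_mult_I)
  qed
qed

lemma positive_multiplier_one: "positive_multiplier (\<lambda>t. 1)"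
  by (auto simp: positive_multiplier_def)

lemma positive_multiplier_const: "c \<ge> 0 \<Longrightarrow> positive_multiplier (\<lambda>t. of_real c)"
  using positive_multiplier_cmult[OF _ positive_multiplier_one] by simp

lemma positive_multiplier_add:
  assumes "positive_multiplier f" "positive_multiplier g"
  shows "positive_multiplier (\<lambda>t. f t + g t)"
  unfolding positive_multiplier_def
proof (intro conjI allI impI)
  show "continuous_on UNIV (\<lambda>t. f t + g t)"
    by (intro continuous_intros positive_multiplierD assms)
  show "norm (f t + g t) \<le> Re (f 0 + g 0)" for t
    using norm_triangle_mono[OF assms[THEN positive_multiplierD(2), of t]] by simp
  show "fourier_nonneg R (\<lambda>t. (f t + g t) * h t)" if "fourier_nonneg R h" for R h
  proof -
    have *: "fourier_nonneg R (\<lambda>t. f t * h t)" "fourier_nonneg R (\<lambda>t. g t * h t)"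
      using assms that by (auto intro: positive_multiplierD)
    have "integral {-R..R} (\<lambda>t. (f t + g t) * h t * cis (- (y * t)))
        = integral {-R..R} (\<lambda>t. f t * h t * cis (- (y * t)))
          + integral {-R..R} (\<lambda>t. g t * h t * cis (- (y * t)))" for y
      using *[THEN fourier_nonneg_integrable, of y] by (simp add: ring_distribs integral_add)
    with * that show ?thesis
      by (auto simp: fourier_nonneg_def ring_distribs intro!: continuous_intros nonneg_Reals_add_I)
  qed
qed

lemma positive_multiplier_mult:
  assumes "positive_multiplier f" "positive_multiplier g"
  shows "positive_multiplier (\<lambda>t. f t * g t)"
  unfolding positive_multiplier_def
proof (intro conjI allI impI)
  show "continuous_on UNIV (\<lambda>t. f t * g t)"
    by (intro continuous_intros positive_multiplierD assms)
  show "norm (f t * g t) \<le> Re (f 0 * g 0)" for t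
  proof -
    have "norm (f t) * norm (g t) \<le> Re (f 0) * Re (g 0)"
      using assms[THEN positive_multiplierD(2), of t]
      by (intro mult_mono) (auto intro: order_trans[OF norm_ge_zero])
    also have "\<dots> = Re (f 0 * g 0)"
      using assms[THEN positive_multiplier_at_0] by (metis Re_complex_of_real of_real_mult)
    finally show ?thesis by (simp add: norm_mult)
  qed
  show "fourier_nonneg R (\<lambda>t. f t * g t * h t)" if "fourier_nonneg R h" for R h
    using positive_multiplierD(3)[OF assms(1) positive_multiplierD(3)[OF assms(2) that]]
    by (simp add: mult.assoc)
qed

lemma positive_multiplier_sum:
  assumes "\<And>k. k \<in> A \<Longrightarrow> positive_multiplier (f k)"
  shows "positive_multiplier (\<lambda>t. \<Sum>k\<in>A. f k t)"
  using assms positive_multiplier_const[of 0]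
  by (induction A rule: infinite_finite_induct) (auto intro!: positive_multiplier_add)

lemma positive_multiplier_prod:
  assumes "\<And>k. k \<in> A \<Longrightarrow> positive_multiplier (f k)"
  shows "positive_multiplier (\<lambda>t. \<Prod>k\<in>A. f k t)"
  using assms
  by (induction A rule: infinite_finite_induct)
    (auto intro!: positive_multiplier_mult positive_multiplier_one)

text \<open>Multiplication by this character translates the transform: its value at \<open>y\<close>
  becomes the old value at \<open>u + y\<close>.\<close>

lemma positive_multiplier_cis: "positive_multiplier (\<lambda>t. cis (- (u * t)))"
  unfolding positive_multiplier_def
proof (intro conjI allI impI)
  show "fourier_nonneg R (\<lambda>t. cis (- (u * t)) * h t)" if h: "fourier_nonneg R h" for R h
  proof -
    have eq: "cis (- (u * t)) * h t * cis (- (y * t)) = h t * cis (- ((u + y) * t))" for t y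
      using cis_mult[of "- (u * t)" "- (y * t)"] by (simp add: ring_distribs mult_ac)
    have "integral {-R..R} (\<lambda>t. cis (- (u * t)) * h t * cis (- (y * t))) \<in> \<real>\<^sub>\<ge>\<^sub>0" for y
      using h by (simp only: fourier_nonneg_def eq)
    then show ?thesis using h by (auto simp: fourier_nonneg_def intro!: continuous_intros)
  qed
qed (auto intro!: continuous_intros)

text \<open>The values \<open>Re (f n 0)\<close> converge, hence are bounded, and they bound every
  \<open>f n\<close> uniformly in \<open>t\<close>. Dominated convergence then carries the
  transforms to the limit, and the nonnegative reals are closed. Pointwise convergence does not
  yield continuity of the limit, so that is a separate hypothesis.\<close>

lemma positive_multiplier_LIMSEQ:
  assumes f: "\<And>n. positive_multiplier (f n)"
    and lim: "\<And>t. (\<lambda>n. f n t) \<longlonglongrightarrow> g t"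
    and g: "continuous_on UNIV g"
  shows "positive_multiplier g"
  unfolding positive_multiplier_def
proof (intro conjI allI impI)
  have *: "(\<lambda>n. Re (f n 0)) \<longlonglongrightarrow> Re (g 0)" by (intro tendsto_intros lim)
  show "norm (g t) \<le> Re (g 0)" for t
    by (rule LIMSEQ_le[OF tendsto_norm[OF lim] *]) (use f positive_multiplierD(2) in blast)
  obtain M where M: "\<forall>n. norm (Re (f n 0)) \<le> M"
    using convergent_imp_Bseq[OF convergentI[OF *]] unfolding Bseq_def by blast
  show "fourier_nonneg R (\<lambda>t. g t * h t)" if h: "fourier_nonneg R h" for R h
    unfolding fourier_nonneg_def
  proof (intro conjI allI)
    have hc: "continuous_on {-R..R} h" using h by (simp add: fourier_nonneg_def)
    show "continuous_on {-R..R} (\<lambda>t. g t * h t)"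
      by (intro continuous_intros hc continuous_on_subset[OF g]) auto
    fix y
    have "(\<lambda>n. integral {-R..R} (\<lambda>t. f n t * h t * cis (- (y * t)))) \<longlonglongrightarrow>
        integral {-R..R} (\<lambda>t. g t * h t * cis (- (y * t)))"
    proof (rule dominated_convergence)
      show "(\<lambda>t. f n t * h t * cis (- (y * t))) integrable_on {-R..R}" for n
        using f h by (intro fourier_nonneg_integrable positive_multiplierD)
      show "(\<lambda>t. M * norm (h t)) integrable_on {-R..R}"
        by (intro integrable_continuous_real continuous_intros hc)
      show "norm (f n t * h t * cis (- (y * t))) \<le> M * norm (h t)" for n t
        using positive_multiplierD(2)[OF f, of n t] M[rule_format, of n]
        by (auto simp: norm_mult intro!: mult_right_mono)
      show "(\<lambda>n. f n t * h t * cis (- (y * t))) \<longlonglongrightarrow> g t * h t * cis (- (y * t))" for t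
        by (intro tendsto_intros lim)
    qed
    moreover have "integral {-R..R} (\<lambda>t. f n t * h t * cis (- (y * t))) \<in> \<real>\<^sub>\<ge>\<^sub>0" for n
      using positive_multiplierD(3)[OF f h] by (simp add: fourier_nonneg_def)
    ultimately show "integral {-R..R} (\<lambda>t. g t * h t * cis (- (y * t))) \<in> \<real>\<^sub>\<ge>\<^sub>0"
      by (rule closed_sequentially[OF closed_nonneg_Reals_complex, rotated])
  qed
qed fact

section \<open>Rational multipliers from weak supermajorization\<close>

text \<open>With z = a + it, 1/z is the integral of exp(-zu) over u > 0. Its Riemann sum with mesh h
  = 1/(m+1) is the geometric series h / (1 - exp(-zh)), whose terms are positive multiples of
  characters. Two limits follow: first the partial sums of the series, then h to 0.\<close>

lemma positive_multiplier_inverse: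
  assumes "a > 0"
  shows "positive_multiplier (\<lambda>t. 1 / Complex a t)"
proof (rule positive_multiplier_LIMSEQ)
  define E where "E m t = exp (- Complex a t / of_nat (Suc m))" for m t
  have E: "E m t = of_real (exp (- a / Suc m)) * cis (- (1 / Suc m * t))" for m t
    unfolding E_def by (simp add: exp_eq_polar complex_eq_iff)
  have E_lt: "norm (E m t) < 1" for m t
    using assms by (simp add: E norm_mult)
  have E_pow: "positive_multiplier (\<lambda>t. E m t ^ k)" for m k
  proof -
    have "positive_multiplier (\<lambda>t. \<Prod>j<k. E m t)"
      unfolding E
      by (intro positive_multiplier_prod positive_multiplier_cmult positive_multiplier_cis) simp
    then show ?thesis by simp
  qed
  show "positive_multiplier (\<lambda>t. of_real (1 / Suc m) * (1 / (1 - E m t)))" for m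
  proof (rule positive_multiplier_cmult)
    show "positive_multiplier (\<lambda>t. 1 / (1 - E m t))"
    proof (rule positive_multiplier_LIMSEQ)
      show "positive_multiplier (\<lambda>t. \<Sum>k<n. E m t ^ k)" for n
        by (intro positive_multiplier_sum E_pow)
      show "(\<lambda>n. \<Sum>k<n. E m t ^ k) \<longlonglongrightarrow> 1 / (1 - E m t)" for t
        using geometric_sums[OF E_lt[of m t]] by (simp add: sums_def)
      show "continuous_on UNIV (\<lambda>t. 1 / (1 - E m t))"
      proof (intro continuous_intros ballI)
        show "continuous_on UNIV (E m)"
          unfolding E_def[abs_def] using of_nat_neq_0[of m, where 'a=complex]
          by (intro continuous_intros) simp
        show "1 - E m t \<noteq> 0" for t
          using E_lt[of m t] by auto
      qed
    qed
  qed simp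
  show "(\<lambda>m. of_real (1 / Suc m) * (1 / (1 - E m t))) \<longlonglongrightarrow> 1 / Complex a t" for t
  proof -
    let ?z = "Complex a t"
    have z: "?z \<noteq> 0" using assms by (simp add: complex_eq_iff)
    \<comment> \<open>The reciprocal of the Riemann sum is a difference quotient at 0 of this
      function of \<open>h\<close>.\<close>
    have "((\<lambda>h. 1 - exp (- ?z * h)) has_field_derivative ?z) (at 0)"
      by (auto intro!: derivative_eq_intros)
    then have "((\<lambda>h. (1 - exp (- ?z * h)) / h) \<longlongrightarrow> ?z) (at 0)"
      by (simp add: has_field_derivative_iff)
    moreover have "filterlim (\<lambda>m. of_real (1 / Suc m) :: complex) (at 0) sequentially"
    proof (rule filterlim_atI)
      show "(\<lambda>m. of_real (1 / Suc m) :: complex) \<longlonglongrightarrow> 0"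
        using tendsto_of_real[OF LIMSEQ_inverse_real_of_nat, where 'a=complex]
        by (simp add: inverse_eq_divide)
      show "\<forall>\<^sub>F m in sequentially. (of_real (1 / Suc m) :: complex) \<noteq> 0"
        by (rule always_eventually) (simp only: of_real_eq_0_iff, simp)
    qed
    ultimately have "(\<lambda>m. (1 - exp (- ?z * of_real (1 / Suc m))) / of_real (1 / Suc m)) \<longlonglongrightarrow> ?z"
      by (rule filterlim_compose)
    from tendsto_divide[OF tendsto_const[of 1] this z] show ?thesis
      by (simp add: E_def mult.commute)
  qed
  show "continuous_on UNIV (\<lambda>t. 1 / Complex a t)"
    using assms by (auto intro!: continuous_intros simp: complex_eq_iff)
qed

text \<open>
  Taking the factors in order, the first-order term of the next factor is absorbed by the slack
  \<open>E / (\<alpha> + it)\<close>, where \<open>E\<close> is the partial sum of \<open>b - a\<close>; hence the stronger induction claim.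
\<close>

lemma positive_multiplier_interlacing:
  assumes pos: "\<And>i. i \<in> {1..q} \<Longrightarrow> 0 < a i"
    and interlace: "\<And>i. i \<in> {1..<q} \<Longrightarrow> b i \<le> a (Suc i)"
    and sums: "\<And>k. k \<in> {1..q} \<Longrightarrow> (\<Sum>i=1..k. a i) \<le> (\<Sum>i=1..k. b i)"
  shows "positive_multiplier (\<lambda>t. \<Prod>i=1..q. Complex (b i) t / Complex (a i) t)"
proof -
  define P where "P k t = (\<Prod>i=1..k. Complex (b i) t / Complex (a i) t)" for k t
  define E where "E k = (\<Sum>i=1..k. b i) - (\<Sum>i=1..k. a i)" for k
  have "positive_multiplier (P k) \<and>
      (\<forall>\<alpha>. 0 < \<alpha> \<longrightarrow> (k = 0 \<or> b k \<le> \<alpha>) \<longrightarrow>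
        positive_multiplier (\<lambda>t. P k t * (1 - of_real (E k) / Complex \<alpha> t)))" if "k \<le> q" for k
    using that
  proof (induction k)
    case 0
    then show ?case by (auto simp: P_def E_def positive_multiplier_one)
  next
    case (Suc k)
    let ?a = "a (Suc k)" and ?b = "b (Suc k)"
    have a: "0 < ?a" and E: "E (Suc k) \<ge> 0"
      using Suc.prems pos sums[of "Suc k"] by (simp_all add: E_def)
    have "k = 0 \<or> b k \<le> ?a" using interlace[of k] Suc.prems by (cases k) auto
    with Suc a have base: "positive_multiplier (\<lambda>t. P k t * (1 - of_real (E k) / Complex ?a t))"
      and Pk: "positive_multiplier (P k)" by auto
    have dE: "?b - ?a = E (Suc k) - E k" by (simp add: E_def)
    have nz: "Complex ?a t \<noteq> 0" for t using a by (simp add: complex_eq_iff)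
    have shift: "Complex ?b t = Complex ?a t + of_real (E (Suc k)) - of_real (E k)" for t
      using dE by (simp add: complex_eq_iff)
    \<comment> \<open>The new factor is 1 + (\<open>E (Suc k)\<close> - \<open>E k\<close>) /
      (\<open>?a\<close> + it). Its negative part goes into \<open>base\<close>; what remains has
      the nonnegative coefficient \<open>E (Suc k)\<close>.\<close>
    have "P (Suc k) = (\<lambda>t. P k t * (1 - of_real (E k) / Complex ?a t)
        + of_real (E (Suc k)) * (P k t * (1 / Complex ?a t)))"
      using nz by (simp add: fun_eq_iff P_def shift field_simps)
    moreover have "positive_multiplier \<dots>"
      using a E by (intro base positive_multiplier_add positive_multiplier_cmult
        positive_multiplier_mult positive_multiplier_inverse Pk)
    ultimately have "positive_multiplier (P (Suc k))" by (simp only:)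
    moreover have "positive_multiplier (\<lambda>t. P (Suc k) t * (1 - of_real (E (Suc k)) / Complex \<alpha> t))"
      if \<alpha>: "0 < \<alpha>" "?b \<le> \<alpha>" for \<alpha>
    proof -
      have nz': "Complex \<alpha> t \<noteq> 0" for t using \<alpha> by (simp add: complex_eq_iff)
      have diff: "of_real (\<alpha> - ?b) = Complex \<alpha> t - Complex ?b t" for t
        by (simp add: complex_eq_iff)
      \<comment> \<open>The terms in \<open>E (Suc k)\<close> combine to \<open>E (Suc k)\<close> /
        (\<open>?a\<close> + it) times 1 - (\<open>?b\<close> + it) / (\<open>\<alpha>\<close> +
        it). The latter equals (\<open>\<alpha>\<close> - \<open>?b\<close>) /
        (\<open>\<alpha>\<close> + it), with nonnegative numerator because \<open>?b\<close> is at
        most \<open>\<alpha>\<close>.\<close>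
      have "P (Suc k) t * (1 - of_real (E (Suc k)) / Complex \<alpha> t)
        = P k t * (1 - of_real (E k) / Complex ?a t)
        + of_real (E (Suc k)) * (P k t * (1 / Complex ?a t)
            * (of_real (\<alpha> - ?b) * (1 / Complex \<alpha> t)))" for t
        unfolding diff[of t] using nz[of t] nz'[of t]
        by (simp add: P_def shift field_simps)
      moreover have "positive_multiplier (\<lambda>t. P k t * (1 - of_real (E k) / Complex ?a t)
        + of_real (E (Suc k)) * (P k t * (1 / Complex ?a t)
            * (of_real (\<alpha> - ?b) * (1 / Complex \<alpha> t))))"
        using a \<alpha> E by (intro base positive_multiplier_add positive_multiplier_cmult
          positive_multiplier_mult positive_multiplier_inverse Pk) auto
      ultimately show ?thesis by (simp only:)
    qed
    ultimately show ?case by blast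
  qed
  then show ?thesis by (auto simp: P_def[abs_def])
qed

lemma weakly_supermajorizedD:
  assumes "weakly_supermajorized q b a"
  shows "i \<in> {1..q} \<Longrightarrow> 0 < a i" "i \<in> {1..q} \<Longrightarrow> 0 < b i"
    "i \<in> {1..q} \<Longrightarrow> j \<in> {1..q} \<Longrightarrow> i \<le> j \<Longrightarrow> a i \<le> a j"
    "i \<in> {1..q} \<Longrightarrow> j \<in> {1..q} \<Longrightarrow> i \<le> j \<Longrightarrow> b i \<le> b j"
    "k \<in> {1..q} \<Longrightarrow> (\<Sum>i=1..k. a i) \<le> (\<Sum>i=1..k. b i)"
  using assms by (auto simp: weakly_supermajorized_def mono_on_def)

lemma weakly_supermajorized_add:
  assumes "weakly_supermajorized q b a" "mono_on {1..q} d"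
    "\<And>i. i \<in> {1..q} \<Longrightarrow> 0 < a i + d i" "\<And>i. i \<in> {1..q} \<Longrightarrow> 0 < b i + d i"
  shows "weakly_supermajorized q (\<lambda>i. b i + d i) (\<lambda>i. a i + d i)"
  using assms by (auto simp: weakly_supermajorized_def mono_on_def sum.distrib intro!: add_mono)

text \<open>The segment from \<open>a\<close> to \<open>b\<close> is cut into \<open>n\<close> equal
  steps \<open>c k\<close>. All points of the segment inherit the gap \<open>\<delta>\<close>, and
  no entry rises by more than \<open>\<delta>\<close> in one step, so consecutive points interlace;
  each step raises partial sums by 1/n of the nonnegative total. The product over all steps
  telescopes.\<close>

lemma positive_multiplier_rational_gap:
  assumes maj: "weakly_supermajorized q b a" and "\<delta> > 0"
    and gap: "\<And>i. i \<in> {1..<q} \<Longrightarrow> a i + \<delta> \<le> a (Suc i)" "\<And>i. i \<in> {1..<q} \<Longrightarrow> b i + \<delta> \<le> b (Suc i)"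
  shows "positive_multiplier (\<lambda>t. \<Prod>i=1..q. Complex (b i) t / Complex (a i) t)"
proof -
  note D = weakly_supermajorizedD[OF maj]
  \<comment> \<open>\<open>M\<close> bounds every displacement \<open>b i - a i\<close>, so taking
    \<open>n\<close> above \<open>M / \<delta>\<close> keeps each single step below the gap.\<close>
  define M where "M = (\<Sum>i=1..q. \<bar>b i - a i\<bar>)"
  obtain n :: nat where n: "M / \<delta> < n" "0 < n"
    using reals_Archimedean2[of "max 0 (M / \<delta>)"] by auto
  define c where "c k i = (1 - k / n) * a i + k / n * b i" for k i
  have c_step: "c (k + 1) i = c k i + (b i - a i) / n" for k i
    by (simp add: c_def add_divide_distrib algebra_simps diff_divide_distrib)
  have small: "(b i - a i) / n \<le> \<delta>" if "i \<in> {1..q}" for i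
  proof -
    have "b i - a i \<le> M"
      using member_le_sum[of i "{1..q}" "\<lambda>i. \<bar>b i - a i\<bar>"] that by (auto simp: M_def)
    then show ?thesis using n \<open>\<delta> > 0\<close> by (simp add: field_simps)
  qed
  have c_pos: "0 < c k i" if "0 \<le> k" "k \<le> n" "i \<in> {1..q}" for k :: real and i
    unfolding c_def using D(1,2)[OF that(3)] that(1,2) n
    by (cases "k = 0") (auto intro!: add_nonneg_pos)
  have c_gap: "c k i + \<delta> \<le> c k (Suc i)" if "0 \<le> k" "k \<le> n" "i \<in> {1..<q}" for k :: real and i
  proof -
    define w where "w = k / n"
    have "(1 - w) * (a i + \<delta>) + w * (b i + \<delta>) \<le> (1 - w) * a (Suc i) + w * b (Suc i)"
      using gap[OF that(3)] that n by (intro add_mono mult_left_mono) (auto simp: w_def)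
    then show ?thesis by (simp add: c_def algebra_simps flip: w_def)
  qed
  have step: "positive_multiplier (\<lambda>t. \<Prod>i=1..q. Complex (c (k + 1) i) t / Complex (c k i) t)"
    if "0 \<le> k" "k + 1 \<le> n" for k :: real
  proof (rule positive_multiplier_interlacing)
    show "0 < c k i" if "i \<in> {1..q}" for i
      using that \<open>0 \<le> k\<close> \<open>k + 1 \<le> n\<close> by (intro c_pos) auto
    show "c (k + 1) i \<le> c k (Suc i)" if "i \<in> {1..<q}" for i
      using c_gap[of k i] small[of i] c_step[of k i] that \<open>0 \<le> k\<close> \<open>k + 1 \<le> n\<close> by auto
    show "(\<Sum>i=1..j. c k i) \<le> (\<Sum>i=1..j. c (k + 1) i)" if "j \<in> {1..q}" for j
      using D(5)[OF that] by (simp add: c_step sum.distrib sum_subtractf flip: sum_divide_distrib)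
  qed
  have "positive_multiplier (\<lambda>t. \<Prod>i=1..q. Complex (c k i) t / Complex (a i) t)" if "k \<le> n" for k :: nat
    using that
  proof (induction k)
    case 0
    have "Complex (a i) t / Complex (a i) t = 1" if "i \<in> {1..q}" for i t
      using D(1)[OF that] by (simp add: complex_eq_iff)
    then show ?case by (simp add: c_def positive_multiplier_one)
  next
    case (Suc k)
    have "(\<Prod>i=1..q. Complex (c (real k + 1) i) t / Complex (c k i) t) *
        (\<Prod>i=1..q. Complex (c k i) t / Complex (a i) t)
      = (\<Prod>i=1..q. Complex (c (real (Suc k)) i) t / Complex (a i) t)" for t
      unfolding prod.distrib[symmetric]
    proof (rule prod.cong[OF refl])
      fix i assume "i \<in> {1..q}"
      then have "Complex (c k i) t \<noteq> 0" using c_pos[of k i] Suc.prems by (simp add: complex_eq_iff)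
      then show "Complex (c (real k + 1) i) t / Complex (c k i) t * (Complex (c k i) t / Complex (a i) t)
          = Complex (c (real (Suc k)) i) t / Complex (a i) t"
        by (simp add: add.commute)
    qed
    with positive_multiplier_mult[OF step[of "real k"] Suc.IH] Suc.prems show ?case by simp
  qed
  from this[of n] n show ?thesis by (simp add: c_def)
qed

text \<open>Adding \<open>\<epsilon> m * i\<close> to the \<open>i\<close>-th entry of both vectors
  leaves the differences of partial sums unchanged and opens a gap \<open>\<epsilon> m\<close>; the
  limit \<open>\<epsilon> m\<close> to 0 removes the perturbation.\<close>

lemma positive_multiplier_rational:
  assumes maj: "weakly_supermajorized q b a"
  shows "positive_multiplier (\<lambda>t. \<Prod>i=1..q. Complex (b i) t / Complex (a i) t)"
proof (rule positive_multiplier_LIMSEQ)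
  note D = weakly_supermajorizedD[OF maj]
  define \<epsilon> where "\<epsilon> m = 1 / real (Suc m)" for m
  have \<epsilon>: "\<epsilon> m > 0" for m by (simp add: \<epsilon>_def)
  have nz: "Complex (a i) t \<noteq> 0" if "i \<in> {1..q}" for i t
    using D(1)[OF that] by (simp add: complex_eq_iff)
  show "positive_multiplier (\<lambda>t. \<Prod>i=1..q. Complex (b i + \<epsilon> m * i) t / Complex (a i + \<epsilon> m * i) t)" for m
  proof (rule positive_multiplier_rational_gap[OF _ \<epsilon>[of m]])
    show "weakly_supermajorized q (\<lambda>i. b i + \<epsilon> m * i) (\<lambda>i. a i + \<epsilon> m * i)"
      using D(1,2) \<epsilon>[of m] less_imp_le[OF \<epsilon>[of m]]
      by (intro weakly_supermajorized_add maj)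
        (auto intro!: mult_left_mono add_pos_nonneg simp: mono_on_def)
  qed (use D(3,4) in \<open>auto simp: algebra_simps\<close>)
  have "\<epsilon> \<longlonglongrightarrow> 0"
    unfolding \<epsilon>_def using LIMSEQ_inverse_real_of_nat by (simp add: inverse_eq_divide)
  then have "(\<lambda>m. \<Prod>i=1..q. Complex (b i + \<epsilon> m * i) t / Complex (a i + \<epsilon> m * i) t) \<longlonglongrightarrow>
      (\<Prod>i=1..q. Complex (b i + 0 * i) t / Complex (a i + 0 * i) t)" for t
    by (intro tendsto_intros) (use nz in auto)
  then show "(\<lambda>m. \<Prod>i=1..q. Complex (b i + \<epsilon> m * i) t / Complex (a i + \<epsilon> m * i) t) \<longlonglongrightarrow>
      (\<Prod>i=1..q. Complex (b i) t / Complex (a i) t)" for t by simp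
  show "continuous_on UNIV (\<lambda>t. \<Prod>i=1..q. Complex (b i) t / Complex (a i) t)"
    by (intro continuous_intros) (use nz in auto)
qed

section \<open>Gamma ratios as positive multipliers\<close>

lemma Complex_notin_nonpos_Ints: "u > 0 \<Longrightarrow> Complex u t \<notin> \<int>\<^sub>\<le>\<^sub>0"
  by (auto elim!: nonpos_Ints_cases simp: complex_eq_iff)

lemma Gamma_Complex_nonzero: "u > 0 \<Longrightarrow> Gamma (Complex u t) \<noteq> 0"
  by (simp add: Gamma_eq_zero_iff Complex_notin_nonpos_Ints)

text \<open>In Euler's limit formula the factorials cancel. There remain a positive constant and the
  rational multipliers for the parameters shifted by k = 0, 1, ..., each of which is again
  supermajorized.\<close>

lemma positive_multiplier_Gamma_ratio:
  assumes maj: "weakly_supermajorized q b a"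
  shows "positive_multiplier (\<lambda>t. \<Prod>i=1..q. Gamma (Complex (a i) t) / Gamma (Complex (b i) t))"
proof (rule positive_multiplier_LIMSEQ)
  note D = weakly_supermajorizedD[OF maj]
  define \<psi> where "\<psi> = (\<Sum>i=1..q. b i - a i)"
  define R where "R k t = (\<Prod>i=1..q. Complex (b i + real k) t / Complex (a i + real k) t)" for k t
  show "positive_multiplier (\<lambda>t. of_real (exp (- \<psi> * ln (Suc n))) * (\<Prod>k=0..Suc n. R k t))" for n
  proof (intro positive_multiplier_cmult positive_multiplier_prod)
    show "positive_multiplier (R k)" for k
      unfolding R_def
      using D(1,2) by (intro positive_multiplier_rational weakly_supermajorized_add maj)
        (auto intro!: add_pos_nonneg simp: mono_on_def)
  qed simp
  have "(\<Prod>i=1..q. Gamma_series (Complex (a i) t) (Suc n) / Gamma_series (Complex (b i) t) (Suc n))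
      = of_real (exp (- \<psi> * ln (Suc n))) * (\<Prod>k=0..Suc n. R k t)" for t n
  proof -
    \<comment> \<open>The two exponents share the imaginary part \<open>t\<close>, so their quotient
      is a positive real number independent of \<open>t\<close>.\<close>
    have "Gamma_series (Complex (a i) t) (Suc n) / Gamma_series (Complex (b i) t) (Suc n)
      = exp (of_real (- (b i - a i) * ln (Suc n))) * (\<Prod>k=0..Suc n. Complex (b i + real k) t / Complex (a i + real k) t)" for i
    proof -
      have shift: "Complex u t + of_nat k = Complex (u + real k) t" for u k
        by (simp add: complex_eq_iff)
      have "exp (of_real (- (b i - a i) * ln (Suc n))) = 
         exp (Complex (a i) t * of_real (ln (Suc n))) / exp (Complex (b i) t * of_real (ln (Suc n)))"
        unfolding exp_diff[symmetric] by (rule arg_cong[of _ _ exp]) (simp add: complex_eq_iff algebra_simps)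
      moreover have poch: "pochhammer (Complex u t) (Suc n + 1) = (\<Prod>k=0..Suc n. Complex (u + real k) t)" for u
        by (simp only: pochhammer_prod shift Suc_eq_plus1[symmetric] atLeastLessThanSuc_atLeastAtMost)
      ultimately show ?thesis
        unfolding Gamma_series_def poch prod_dividef by (simp only: divide_simps) (simp del: of_nat_Suc)
    qed
    then have "(\<Prod>i=1..q. Gamma_series (Complex (a i) t) (Suc n) / Gamma_series (Complex (b i) t) (Suc n))
      = (\<Prod>i=1..q. exp (of_real (- (b i - a i) * ln (Suc n)))) * (\<Prod>i=1..q. \<Prod>k=0..Suc n. Complex (b i + real k) t / Complex (a i + real k) t)"
      by (simp only: prod.distrib)
    also have "(\<Prod>i=1..q. \<Prod>k=0..Suc n. Complex (b i + real k) t / Complex (a i + real k) t) = (\<Prod>k=0..Suc n. R k t)"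
      unfolding R_def by (rule prod.swap)
    also have "(\<Prod>i=1..q. exp (complex_of_real (- (b i - a i) * ln (Suc n)))) = of_real (exp (- \<psi> * ln (Suc n)))"
    proof -
      have "- \<psi> * ln (Suc n) = (\<Sum>i=1..q. - (b i - a i) * ln (Suc n))"
        unfolding \<psi>_def sum_negf[symmetric] sum_distrib_right by (rule refl)
      then show ?thesis by (simp only: exp_sum of_real_prod exp_of_real finite_atLeastAtMost)
    qed
    finally show ?thesis .
  qed
  moreover have "(\<lambda>n. \<Prod>i=1..q. Gamma_series (Complex (a i) t) (Suc n) / Gamma_series (Complex (b i) t) (Suc n))
      \<longlonglongrightarrow> (\<Prod>i=1..q. Gamma (Complex (a i) t) / Gamma (Complex (b i) t))" for t
    using D(1,2)
    by (intro tendsto_intros LIMSEQ_Suc Gamma_series_LIMSEQ) (auto simp: Gamma_Complex_nonzero)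
  ultimately show "(\<lambda>n. of_real (exp (- \<psi> * ln (Suc n))) * (\<Prod>k=0..Suc n. R k t))
      \<longlonglongrightarrow> (\<Prod>i=1..q. Gamma (Complex (a i) t) / Gamma (Complex (b i) t))" for t
    by simp
  show "continuous_on UNIV (\<lambda>t. \<Prod>i=1..q. Gamma (Complex (a i) t) / Gamma (Complex (b i) t))"
    using D(1,2)
    by (intro continuous_intros continuous_on_compose2[OF continuous_on_Gamma[of "- \<int>\<^sub>\<le>\<^sub>0"]])
      (auto simp: Gamma_Complex_nonzero Complex_notin_nonpos_Ints)
qed

section \<open>Decay of Gamma ratios along vertical lines\<close>

lemma norm_Gamma_ratio_le:
  assumes "weakly_supermajorized q b a"
  shows "norm (\<Prod>i=1..q. Gamma (Complex (a i) t) / Gamma (Complex (b i) t))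
    \<le> (\<Prod>i=1..q. Gamma (a i) / Gamma (b i))"
proof -
  have "(\<Prod>i=1..q. Gamma (Complex (a i) 0) / Gamma (Complex (b i) 0))
      = of_real (\<Prod>i=1..q. Gamma (a i) / Gamma (b i))"
    by (simp add: Gamma_complex_of_real flip: complex_of_real_def)
  with positive_multiplierD(2)[OF positive_multiplier_Gamma_ratio[OF assms], of t] show ?thesis
    by (simp only: Re_complex_of_real)
qed

text \<open>
  After normalisation at \<open>t = 0\<close>, \<open>\<bar>\<Gamma>(y + it) / \<Gamma>(y + 1/n + it)\<bar>\<close> increases with \<open>y\<close>, and the
  product of these ratios over \<open>y = x, x + 1/n, \<dots>, x + (n - 1)/n\<close> is \<open>1 / \<bar>x + it\<bar>\<close>.
\<close>

lemma norm_Gamma_quotient_le: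
  assumes "x > 0" "n > 0"
  shows "norm (Gamma (Complex x t) / Gamma (Complex (x + 1 / real n) t))
    \<le> Gamma x / Gamma (x + 1 / real n) * (x / norm (Complex x t)) powr (1 / real n)"
proof -
  define \<delta> where "\<delta> = 1 / real n"
  have \<delta>: "\<delta> > 0" using assms by (simp add: \<delta>_def)
  define g where "g j = norm (Gamma (Complex (x + real j * \<delta>) t)) / Gamma (x + real j * \<delta>)" for j
  have xj: "x + real j * \<delta> > 0" for j using assms \<delta> by (intro add_pos_nonneg) auto
  have nz: "Gamma (Complex (x + real j * \<delta>) t) \<noteq> 0" for j
    by (rule Gamma_Complex_nonzero[OF xj])
  have gpos: "g j > 0" for j
    unfolding g_def using nz xj by (auto intro!: divide_pos_pos Gamma_real_pos)
  have mono: "g 0 / g 1 \<le> g j / g (Suc j)" for j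
  proof (cases "j = 0")
    case False
    \<comment> \<open>The pairs (x, x + (j+1)\<open>\<delta>\<close>) and (x +
      \<open>\<delta>\<close>, x + j\<open>\<delta>\<close>) have equal sums, and the second is
      majorized by the first; the bound for their Gamma ratio is the desired comparison. For j = 0
      the second pair would not be increasing, but then the two sides coincide.\<close>
    define a where "a i = (if i = (1::nat) then x else x + real (Suc j) * \<delta>)" for i
    define b where "b i = (if i = (1::nat) then x + real 1 * \<delta> else x + real j * \<delta>)" for i
    have 2: "{1..2} = {1, 2::nat}" by auto
    have "weakly_supermajorized 2 b a"
      unfolding weakly_supermajorized_def 2
      using assms \<delta> xj[of j] xj[of "Suc j"] xj[of 1] False
      by (auto simp: a_def b_def mono_on_def algebra_simps 2 One_nat_def[symmetric] simp del: One_nat_def)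
    from norm_Gamma_ratio_le[OF this, of t]
    have "norm (Gamma (Complex (x + real 0 * \<delta>) t)) / norm (Gamma (Complex (x + real 1 * \<delta>) t))
        * (norm (Gamma (Complex (x + real (Suc j) * \<delta>) t)) / norm (Gamma (Complex (x + real j * \<delta>) t)))
      \<le> Gamma (x + real 0 * \<delta>) / Gamma (x + real 1 * \<delta>) * (Gamma (x + real (Suc j) * \<delta>) / Gamma (x + real j * \<delta>))"
      unfolding 2 by (simp add: a_def b_def norm_mult norm_divide)
    then show ?thesis
      using nz[of 0] nz[of 1] nz[of j] nz[of "Suc j"] xj[of 0, THEN Gamma_real_pos]
        xj[of 1, THEN Gamma_real_pos] xj[of j, THEN Gamma_real_pos] xj[of "Suc j", THEN Gamma_real_pos]
      unfolding g_def by (simp add: field_simps)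
  qed simp
  have "(g 0 / g 1) ^ n \<le> (\<Prod>j<n. g j / g (Suc j))"
    using prod_mono[of "{..<n}" "\<lambda>_. g 0 / g 1" "\<lambda>j. g j / g (Suc j)"] mono less_imp_le[OF gpos]
    by simp
  also have "\<dots> = g 0 / g n"
    using gpos by (intro prod_lessThan_telescope') (metis less_irrefl)
  also have "\<dots> = x / norm (Complex x t)"
  proof -
    have "Complex (x + 1) t = Complex x t + 1" by (simp add: complex_eq_iff)
    then have "Gamma (Complex (x + 1) t) = Complex x t * Gamma (Complex x t)"
      using assms by (auto intro!: Gamma_plus1 Complex_notin_nonpos_Ints)
    moreover have "Gamma (x + 1) = x * Gamma x"
      using assms by (auto intro!: Gamma_plus1 elim!: nonpos_Ints_cases)
    moreover have "x + real n * \<delta> = x + 1" using assms by (simp add: \<delta>_def)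
    ultimately show ?thesis
      using nz[of 0] Gamma_real_pos[OF assms(1)] unfolding g_def by (simp add: norm_mult field_simps)
  qed
  finally have le: "(g 0 / g 1) ^ n \<le> x / norm (Complex x t)" .
  have "g 0 / g 1 = ((g 0 / g 1) ^ n) powr \<delta>"
    using gpos[of 0] gpos[of 1] assms by (simp add: \<delta>_def powr_powr flip: powr_realpow)
  also have "\<dots> \<le> (x / norm (Complex x t)) powr \<delta>"
    using le gpos[of 0] gpos[of 1] \<delta> by (intro powr_mono2) auto
  finally have "g 0 / g 1 \<le> (x / norm (Complex x t)) powr \<delta>" .
  moreover have "norm (Gamma (Complex x t) / Gamma (Complex (x + \<delta>) t)) = Gamma x / Gamma (x + \<delta>) * (g 0 / g 1)"
    using xj[of 0, THEN Gamma_real_pos] xj[of 1, THEN Gamma_real_pos]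
    by (simp add: g_def norm_divide)
  moreover have "0 \<le> Gamma x / Gamma (x + \<delta>)"
    using xj[of 0, THEN Gamma_real_pos] xj[of 1, THEN Gamma_real_pos] by simp
  ultimately show ?thesis
    unfolding \<delta>_def[symmetric] by (simp only: mult_left_mono)
qed

text \<open>Raising the largest entry \<open>a q\<close> keeps the order and changes only the full
  sum, where the excess leaves room for 1/n. The modified ratio is bounded by its value at
  \<open>t = 0\<close>; the quotient undoing the change supplies the decay.\<close>

lemma norm_Gamma_ratio_decay:
  assumes "weakly_supermajorized q b a" "q \<ge> 1" "n > 0" "1 / real n \<le> (\<Sum>i=1..q. b i - a i)"
  shows "norm (\<Prod>i=1..q. Gamma (Complex (a i) t) / Gamma (Complex (b i) t))
    \<le> (\<Prod>i=1..q. Gamma (a i) / Gamma (b i)) * (a q / norm (Complex (a q) t)) powr (1 / real n)"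
proof -
  note D = weakly_supermajorizedD[OF assms(1)]
  define a' where "a' = a(q := a q + 1 / real n)"
  have aq: "a q > 0" using D(1) assms by auto
  have a': "a' q = a q + 1 / real n" "i \<noteq> q \<Longrightarrow> a' i = a i" for i by (auto simp: a'_def)
  have split: "(\<Prod>i=1..q. f i) = (\<Prod>i=1..<q. f i) * f q" for f :: "nat \<Rightarrow> 'b::comm_monoid_mult"
    using assms(2) prod.atLeastLessThan_Suc[of 1 q f] by (simp add: atLeastLessThanSuc_atLeastAtMost)
  have ssplit: "(\<Sum>i=1..q. f i) = (\<Sum>i=1..<q. f i) + f q" for f :: "nat \<Rightarrow> real"
    using assms(2) sum.atLeastLessThan_Suc[of 1 q f] by (simp add: atLeastLessThanSuc_atLeastAtMost)
  have "weakly_supermajorized q b a'"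
    unfolding weakly_supermajorized_def
  proof (intro conjI ballI)
    show "mono_on {1..q} a'"
      using D(3) by (auto simp: mono_on_def a'_def intro: order_trans[of _ "a q"])
    show "(\<Sum>i=1..k. a' i) \<le> (\<Sum>i=1..k. b i)" if "k \<in> {1..q}" for k
    proof (cases "k = q")
      case True
      have "(\<Sum>i=1..<q. a' i) = (\<Sum>i=1..<q. a i)"
        by (intro sum.cong) (auto simp: a'_def)
      then have "(\<Sum>i=1..q. a' i) = (\<Sum>i=1..q. a i) + 1 / real n"
        unfolding ssplit a'(1) by simp
      then show ?thesis using assms(4) True by (simp add: sum_subtractf)
    next
      case False
      then have "(\<Sum>i=1..k. a' i) = (\<Sum>i=1..k. a i)"
        using that by (intro sum.cong) (auto simp: a'_def)
      then show ?thesis using D(5)[OF that] by simp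
    qed
  qed (use D aq in \<open>auto simp: a'_def mono_on_def intro!: add_pos_nonneg\<close>)
  from norm_Gamma_ratio_le[OF this, of t]
  have 1: "norm (\<Prod>i=1..q. Gamma (Complex (a' i) t) / Gamma (Complex (b i) t))
    \<le> (\<Prod>i=1..q. Gamma (a' i) / Gamma (b i))" .
  have pos: "a q + 1 / real n > 0" using aq by (auto intro!: add_pos_nonneg)
  have nz: "Gamma (a q + 1 / real n) \<noteq> 0" "Gamma (Complex (a q + 1 / real n) t) \<noteq> 0"
    using Gamma_real_pos[OF pos] Gamma_Complex_nonzero[OF pos] by auto
  have mid: "(\<Prod>i=1..<q. Gamma (Complex (a' i) t) / Gamma (Complex (b i) t))
      = (\<Prod>i=1..<q. Gamma (Complex (a i) t) / Gamma (Complex (b i) t))"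
    "(\<Prod>i=1..<q. Gamma (a' i) / Gamma (b i)) = (\<Prod>i=1..<q. Gamma (a i) / Gamma (b i))"
    by (auto simp: a'_def intro!: prod.cong)
  have "norm (\<Prod>i=1..q. Gamma (Complex (a i) t) / Gamma (Complex (b i) t))
    = norm (\<Prod>i=1..q. Gamma (Complex (a' i) t) / Gamma (Complex (b i) t))
      * norm (Gamma (Complex (a q) t) / Gamma (Complex (a q + 1 / real n) t))"
    unfolding split mid a'(1) using nz by (simp add: norm_mult norm_divide)
  also have "\<dots> \<le> (\<Prod>i=1..q. Gamma (a' i) / Gamma (b i)) * (Gamma (a q) / Gamma (a q + 1 / real n)
      * (a q / norm (Complex (a q) t)) powr (1 / real n))"
    by (intro mult_mono[OF 1 norm_Gamma_quotient_le] aq assms order_trans[OF norm_ge_zero 1]) auto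
  also have "\<dots> = (\<Prod>i=1..q. Gamma (a i) / Gamma (b i)) * (a q / norm (Complex (a q) t)) powr (1 / real n)"
    unfolding split mid a'(1) using nz by simp
  finally show ?thesis .
qed

section \<open>Two estimates behind convergence\<close>

text \<open>The derivative is absolutely integrable near infinity, so \<open>D\<close> satisfies the
  Cauchy criterion.\<close>

lemma tendsto_at_top_of_derivative_bound:
  fixes D :: "real \<Rightarrow> 'a::banach"
  assumes D: "\<And>t. t \<ge> 1 \<Longrightarrow> (D has_vector_derivative D' t) (at t)"
    and bound: "\<And>t. t \<ge> 1 \<Longrightarrow> norm (D' t) \<le> K * t powr (- \<delta> - 1)"
    and "\<delta> > 0"
  shows "\<exists>L. (D \<longlongrightarrow> L) at_top"
proof -
  \<comment> \<open>This is the absolute value of the integral of the derivative bound from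
    \<open>t\<close> to infinity.\<close>
  define B where "B t = \<bar>K / \<delta>\<bar> * t powr (- \<delta>)" for t
  have near: "dist (D t) (D u) \<le> B t" if "1 \<le> t" "t < u" for t u
  proof -
    have "norm (D u - D t) \<le> (- K / \<delta> * u powr (- \<delta>)) - (- K / \<delta> * t powr (- \<delta>))"
    proof (rule differentiable_bound_general[OF \<open>t < u\<close>])
      show "continuous_on {t..u} D"
        using that by (intro continuous_at_imp_continuous_on ballI has_vector_derivative_continuous[OF D]) auto
      show "continuous_on {t..u} (\<lambda>t. - K / \<delta> * t powr (- \<delta>))"
        using that by (intro continuous_intros) auto
      show "(D has_vector_derivative D' y) (at y)" "norm (D' y) \<le> K * y powr (- \<delta> - 1)"
        if "t < y" for y using D bound that \<open>1 \<le> t\<close> by auto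
      show "((\<lambda>t. - K / \<delta> * t powr (- \<delta>)) has_vector_derivative K * y powr (- \<delta> - 1)) (at y)"
        if "t < y" for y
        using that \<open>1 \<le> t\<close> \<open>\<delta> > 0\<close> unfolding has_real_derivative_iff_has_vector_derivative[symmetric]
        by (auto intro!: derivative_eq_intros simp: field_simps)
    qed
    also have "\<dots> = K / \<delta> * (t powr (- \<delta>) - u powr (- \<delta>))"
      by (simp add: algebra_simps)
    also have "\<dots> \<le> B t"
      unfolding B_def using that \<open>\<delta> > 0\<close> powr_mono2'[of "- \<delta>" t u]
      by (intro mult_mono) (auto intro: divide_right_mono)
    finally show ?thesis by (simp add: dist_norm norm_minus_commute)
  qed
  have B: "(B \<longlongrightarrow> 0) at_top"
    unfolding B_def using \<open>\<delta> > 0\<close>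
    by (intro tendsto_mult_right_zero tendsto_neg_powr filterlim_ident) auto
  have "\<exists>L. filtermap D at_top \<le> nhds L"
  proof (rule cauchy_filter_complete_converges[OF _ complete_UNIV])
    show "cauchy_filter (filtermap D at_top)"
      unfolding cauchy_filter_metric_filtermap
    proof (intro allI impI)
      fix e :: real assume "e > 0"
      then have "\<forall>\<^sub>F t in at_top. t \<ge> 1 \<and> B t < e"
        by (intro eventually_conj eventually_ge_at_top order_tendstoD(2)[OF B])
      moreover have "dist (D t) (D u) < e" if "t \<ge> 1 \<and> B t < e" "u \<ge> 1 \<and> B u < e" for t u
        using near[of t u] near[of u t] that \<open>e > 0\<close>
        by (cases t u rule: linorder_cases) (auto simp: dist_commute)
      ultimately show "\<exists>P. eventually P at_top \<and> (\<forall>t u. P t \<and> P u \<longrightarrow> dist (D t) (D u) < e)"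
        by blast
    qed
  qed (auto simp: filtermap_bot_iff)
  then show ?thesis by (simp add: filterlim_def)
qed

text \<open>Each quotient is 1 + (a - b) / (b + it), hence 1 + O(1/|t|), and finite products keep
  this form. The condition on \<open>t\<close> keeps the denominators away from 0.\<close>

lemma norm_one_minus_prod_Complex_quotient_le:
  fixes q :: nat
  shows "\<exists>M. \<forall>t. \<bar>t\<bar> \<ge> 1 \<longrightarrow> norm (1 - (\<Prod>i=1..q. Complex (a i) t / Complex (b i) t)) \<le> M / \<bar>t\<bar>"
proof (induction q)
  case 0
  show ?case by (auto intro!: exI[of _ 0])
next
  case (Suc q)
  then obtain M where M: "\<And>t. \<bar>t\<bar> \<ge> 1 \<Longrightarrow>
      norm (1 - (\<Prod>i=1..q. Complex (a i) t / Complex (b i) t)) \<le> M / \<bar>t\<bar>" by blast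
  have M0: "M \<ge> 0" using order_trans[OF norm_ge_zero M[of 1]] by simp
  let ?d = "\<bar>a (Suc q) - b (Suc q)\<bar>"
  have "norm (1 - (\<Prod>i=1..Suc q. Complex (a i) t / Complex (b i) t)) \<le> (M + (1 + M) * ?d) / \<bar>t\<bar>"
    if t: "\<bar>t\<bar> \<ge> 1" for t
  proof -
    define P where "P = (\<Prod>i=1..q. Complex (a i) t / Complex (b i) t)"
    have nz: "Complex (b (Suc q)) t \<noteq> 0" using t by (auto simp: complex_eq_iff)
    have "norm P \<le> norm (1 - P) + 1"
      using norm_triangle_ineq4[of 1 "1 - P"] by simp
    also have "norm (1 - P) \<le> M / \<bar>t\<bar>"
      unfolding P_def by (rule M[OF t])
    also have "\<dots> \<le> M"
      using t M0 frac_le[of M M 1 "\<bar>t\<bar>"] by simp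
    finally have P: "norm P \<le> 1 + M" by simp
    have "1 - P * (Complex (a (Suc q)) t / Complex (b (Suc q)) t)
        = (1 - P) - P * (of_real (a (Suc q) - b (Suc q)) / Complex (b (Suc q)) t)"
    proof -
      have "Complex (a (Suc q)) t = Complex (b (Suc q)) t + of_real (a (Suc q) - b (Suc q))"
        by (simp add: complex_eq_iff)
      then show ?thesis
        using nz by (simp add: add_divide_distrib distrib_left del: of_real_diff)
    qed
    also have "norm \<dots> \<le> norm (1 - P) + norm P * (?d / norm (Complex (b (Suc q)) t))"
      by (rule order_trans[OF norm_triangle_ineq4]) (simp add: norm_mult norm_divide del: of_real_diff)
    also have "\<dots> \<le> M / \<bar>t\<bar> + (1 + M) * (?d / \<bar>t\<bar>)"
    proof (intro add_mono mult_mono)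
      show "norm (1 - P) \<le> M / \<bar>t\<bar>" unfolding P_def by (rule M[OF t])
      show "?d / norm (Complex (b (Suc q)) t) \<le> ?d / \<bar>t\<bar>"
        using abs_Im_le_cmod[of "Complex (b (Suc q)) t"] t by (intro frac_le) auto
    qed (use P M0 in auto)
    finally show ?thesis by (simp add: P_def add_divide_distrib)
  qed
  then show ?case by blast
qed

section \<open>The integrand on its half-plane\<close>

lemma of_real_add_Complex: "of_real u + Complex c t = Complex (u + c) t"
  by (simp add: complex_eq_iff)

lemma meijer_integrand_Complex:
  "meijer_integrand q b a x (Complex c t) =
    (\<Prod>i=1..q. Gamma (Complex (a i + c) t) / Gamma (Complex (b i + c) t)) * of_real x powr (- Complex c t)"
  by (simp add: meijer_integrand_def of_real_add_Complex prod_dividef)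

text \<open>Partial sums at k = 1 give \<open>a 1\<close> at most \<open>b 1\<close>, so
  \<open>a 1\<close> is the least entry of both vectors, and adding \<open>c\<close> keeps all of
  them positive.\<close>

lemma weakly_supermajorized_add_const:
  assumes "weakly_supermajorized q b a" "q \<ge> 1" "c > - a 1"
  shows "weakly_supermajorized q (\<lambda>i. b i + c) (\<lambda>i. a i + c)"
proof -
  note D = weakly_supermajorizedD[OF assms(1)]
  have "a 1 \<le> b 1" using D(5)[of 1] assms by simp
  moreover have "a 1 \<le> a i" "b 1 \<le> b i" if "i \<in> {1..q}" for i
    using D(3,4)[of 1 i] that assms by auto
  ultimately show ?thesis using assms(3)
    by (intro weakly_supermajorized_add assms(1)) (fastforce simp: mono_on_def)+
qed

locale meijer =
  fixes q :: nat and a b :: "nat \<Rightarrow> real" and x :: real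
  assumes q: "q \<ge> 1" and maj: "weakly_supermajorized q b a"
    and excess: "(\<Sum>i=1..q. b i - a i) > 0" and x: "0 < x" "x < 1"
begin

abbreviation "f \<equiv> meijer_integrand q b a x"
abbreviation "halfplane \<equiv> {s. Re s > - a 1}"

lemmas maj_shift = weakly_supermajorized_add_const[OF maj q]

lemma f_holomorphic: "f holomorphic_on halfplane"
proof -
  have "a i + Re s > 0" "b i + Re s > 0" if "i \<in> {1..q}" "s \<in> halfplane" for i s
    using weakly_supermajorizedD(1,2)[OF maj_shift[of "Re s"]] that by auto
  moreover have "of_real u + s = Complex (u + Re s) (Im s)" for u s
    by (simp add: complex_eq_iff)
  ultimately have "of_real (a i) + s \<notin> \<int>\<^sub>\<le>\<^sub>0" "of_real (b i) + s \<notin> \<int>\<^sub>\<le>\<^sub>0" if "i \<in> {1..q}" "s \<in> halfplane" for i s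
    using that Complex_notin_nonpos_Ints by simp_all
  then show ?thesis unfolding meijer_integrand_def
    using x by (intro holomorphic_intros) (auto simp: Gamma_eq_zero_iff)
qed

text \<open>The decay estimate applies to the parameters shifted by \<open>c\<close>, whose excess
  is the same. Its constant is continuous in \<open>c\<close>, hence bounded on the compact
  interval; this uniformity is what permits moving the line of integration.\<close>

lemma norm_f_le:
  assumes "- a 1 < c1" "n > 0" "1 / real n \<le> (\<Sum>i=1..q. b i - a i)"
  obtains K where "\<And>c t. c \<in> {c1..c2} \<Longrightarrow> t \<noteq> 0 \<Longrightarrow>
    norm (f (Complex c t)) \<le> K * \<bar>t\<bar> powr (- (1 / real n))"
proof -
  define C where "C c = (\<Prod>i=1..q. Gamma (a i + c) / Gamma (b i + c)) * (a q + c) powr (1 / n) * x powr (- c)" for c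
  have pos: "a i + c > 0" "b i + c > 0" if "i \<in> {1..q}" "c \<ge> c1" for i c
    using weakly_supermajorizedD(1,2)[OF maj_shift[of c]] that assms(1) by auto
  have "continuous_on {c1..c2} C"
    unfolding C_def using pos x q
    by (intro continuous_intros continuous_on_compose2[OF continuous_on_Gamma[of "{0<..}"]])
      (force simp: Gamma_eq_zero_iff elim!: nonpos_Ints_cases)+
  from compact_continuous_image[OF this] have "bounded (C ` {c1..c2})"
    by (simp add: compact_imp_bounded)
  then obtain K where K: "\<forall>c\<in>{c1..c2}. norm (C c) \<le> K"
    unfolding bounded_iff by auto
  show thesis
  proof (rule that)
    fix c t :: real assume c: "c \<in> {c1..c2}" and t: "t \<noteq> 0"
    have aq: "a q + c > 0" using pos[of q] c q by auto
    have "norm (f (Complex c t)) = norm (\<Prod>i=1..q. Gamma (Complex (a i + c) t) / Gamma (Complex (b i + c) t)) * x powr (- c)"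
      using x by (simp add: meijer_integrand_Complex norm_mult norm_powr_real_powr)
    also have "\<dots> \<le> (\<Prod>i=1..q. Gamma (a i + c) / Gamma (b i + c))
        * ((a q + c) / norm (Complex (a q + c) t)) powr (1 / n) * x powr (- c)"
      using c assms q by (intro mult_right_mono norm_Gamma_ratio_decay maj_shift) auto
    also have "\<dots> \<le> (\<Prod>i=1..q. Gamma (a i + c) / Gamma (b i + c))
        * ((a q + c) powr (1 / n) * \<bar>t\<bar> powr (- (1 / n))) * x powr (- c)"
    proof (intro mult_right_mono mult_left_mono prod_nonneg)
      have "((a q + c) / norm (Complex (a q + c) t)) powr (1 / n) \<le> ((a q + c) / \<bar>t\<bar>) powr (1 / n)"
        using abs_Im_le_cmod[of "Complex (a q + c) t"] t aq
        by (intro powr_mono2 frac_le) auto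
      also have "\<dots> = (a q + c) powr (1 / n) * \<bar>t\<bar> powr (- (1 / n))"
        using aq by (simp add: powr_divide powr_minus_divide)
      finally show "((a q + c) / norm (Complex (a q + c) t)) powr (1 / n)
        \<le> (a q + c) powr (1 / n) * \<bar>t\<bar> powr (- (1 / n))" .
    qed (use pos c in \<open>auto intro!: divide_nonneg_nonneg less_imp_le[OF Gamma_real_pos]\<close>)
    also have "\<dots> = C c * \<bar>t\<bar> powr (- (1 / n))" by (simp add: C_def mult_ac)
    also have "\<dots> \<le> K * \<bar>t\<bar> powr (- (1 / n))"
      using bspec[OF K c] by (intro mult_right_mono) auto
    finally show "norm (f (Complex c t)) \<le> K * \<bar>t\<bar> powr (- (1 / real n))" .
  qed
qed

text \<open>Each Gamma factor obeys its functional equation, and the factor \<open>x\<close>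
  compensates the change of the power of \<open>x\<close>.\<close>

lemma f_shift:
  assumes "c > - a 1"
  shows "of_real x * f (Complex (c + 1) t)
    = f (Complex c t) * (\<Prod>i=1..q. Complex (a i + c) t / Complex (b i + c) t)"
proof -
  have pos: "a i + c > 0" "b i + c > 0" if "i \<in> {1..q}" for i
    using weakly_supermajorizedD(1,2)[OF maj_shift[of c]] that assms(1) by auto
  have G: "Gamma (Complex (u + 1) t) = Complex u t * Gamma (Complex u t)" if "u > 0" for u
    using Gamma_plus1[OF Complex_notin_nonpos_Ints[OF that, of t]] of_real_add_Complex[of 1 u t]
    by (simp add: add.commute)
  have "(\<Prod>i=1..q. Gamma (Complex (a i + (c + 1)) t) / Gamma (Complex (b i + (c + 1)) t))
    = (\<Prod>i=1..q. Gamma (Complex (a i + c) t) / Gamma (Complex (b i + c) t))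
      * (\<Prod>i=1..q. Complex (a i + c) t / Complex (b i + c) t)"
    unfolding prod.distrib[symmetric]
    using pos G by (intro prod.cong refl) (simp add: add.assoc[symmetric] mult.commute)
  moreover have "of_real x * of_real x powr (- Complex (c + 1) t) = of_real x powr (- Complex c t)"
  proof -
    have "- Complex (c + 1) t = - Complex c t - 1" by (simp add: complex_eq_iff)
    then show ?thesis using x by (simp add: powr_diff)
  qed
  ultimately show ?thesis by (simp add: meijer_integrand_Complex algebra_simps)
qed

end

section \<open>Convergence of the defining integral\<close>

context meijer
begin

text \<open>For a primitive, convergence of the integral means convergence at the two ends of the
  line; \<open>\<sigma>\<close> selects the upper or the lower end. The same \<open>L\<close> serves
  all \<open>c\<close>, which makes the integral independent of the abscissa.\<close>

lemma primitive_ends_converge: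
  assumes G: "\<And>s. s \<in> halfplane \<Longrightarrow> (G has_field_derivative f s) (at s)"
    and \<sigma>: "\<sigma> \<in> {1, -1}"
  obtains L where "\<And>c. c > - a 1 \<Longrightarrow> ((\<lambda>t. G (Complex c (\<sigma> * t))) \<longlongrightarrow> L) at_top"
proof -
  obtain n :: nat where n: "n > 0" "1 / real n \<le> (\<Sum>i=1..q. b i - a i)"
    using reals_Archimedean[OF excess] by (auto simp: inverse_eq_divide simp del: of_nat_Suc intro: less_imp_le)
  define \<delta> where "\<delta> = 1 / real n"
  have \<delta>: "\<delta> > 0" using n by (simp add: \<delta>_def)
  have decay: "((\<lambda>t. t powr (- \<delta>)) \<longlongrightarrow> 0) at_top"
    using \<delta> by (intro tendsto_neg_powr filterlim_ident) auto
  \<comment> \<open>The difference is the integral of \<open>f\<close> over a horizontal segment of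
    fixed length, on which \<open>f\<close> is uniformly O(t^(-\<open>\<delta>\<close>)).\<close>
  have close: "((\<lambda>t. G (Complex c (\<sigma> * t)) - G (Complex c' (\<sigma> * t))) \<longlongrightarrow> 0) at_top"
    if c: "c > - a 1" "c' > - a 1" for c c'
  proof -
    let ?l = "min c c'" and ?u = "max c c'"
    obtain K where K: "\<And>c t. c \<in> {?l..?u} \<Longrightarrow> t \<noteq> 0 \<Longrightarrow> norm (f (Complex c t)) \<le> K * \<bar>t\<bar> powr (- \<delta>)"
      using norm_f_le[OF _ n, of ?l ?u] c unfolding \<delta>_def by auto
    have "norm (G (Complex c (\<sigma> * t)) - G (Complex c' (\<sigma> * t))) \<le> K * \<bar>c - c'\<bar> * t powr (- \<delta>)"
      if t: "t > 0" for t
    proof -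
      define S where "S = closed_segment (Complex c (\<sigma> * t)) (Complex c' (\<sigma> * t))"
      have S: "\<exists>r\<in>{?l..?u}. s = Complex r (\<sigma> * t)" if "s \<in> S" for s
      proof
        show "s = Complex (Re s) (\<sigma> * t)"
          using that unfolding S_def by (subst (asm) closed_segment_same_Im) (auto simp: complex_eq_iff)
        show "Re s \<in> {?l..?u}"
          using that unfolding S_def
          by (subst (asm) closed_segment_same_Im) (auto simp: closed_segment_eq_real_ivl split: if_splits)
      qed
      have "norm (G (Complex c (\<sigma> * t)) - G (Complex c' (\<sigma> * t)))
          \<le> (K * t powr (- \<delta>)) * norm (Complex c (\<sigma> * t) - Complex c' (\<sigma> * t))"
      proof (rule field_differentiable_bound)
        show "convex S" "Complex c (\<sigma> * t) \<in> S" "Complex c' (\<sigma> * t) \<in> S" by (auto simp: S_def)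
        fix s assume "s \<in> S"
        then obtain r where r: "r \<in> {?l..?u}" "s = Complex r (\<sigma> * t)" using S by blast
        then show "(G has_field_derivative f s) (at s within S)"
          using c by (auto intro!: has_field_derivative_at_within G)
        show "norm (f s) \<le> K * t powr (- \<delta>)"
          using K[OF r(1), of "\<sigma> * t"] r t \<sigma> by auto
      qed
      also have "Complex c (\<sigma> * t) - Complex c' (\<sigma> * t) = of_real (c - c')"
        by (simp add: complex_eq_iff)
      finally show ?thesis by (simp only: norm_of_real mult_ac)
    qed
    then have "\<forall>\<^sub>F t in at_top. norm (G (Complex c (\<sigma> * t)) - G (Complex c' (\<sigma> * t)))
        \<le> K * \<bar>c - c'\<bar> * t powr (- \<delta>)"
      using eventually_gt_at_top by (rule eventually_mono[rotated])
    then show ?thesis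
      by (rule Lim_null_comparison) (rule tendsto_mult_right_zero[OF decay])
  qed
  text \<open>
    Since \<open>x f(s + 1) = f(s) \<Prod>(a + s) / (b + s)\<close>, the difference \<open>f(s) - x f(s + 1)\<close> gains a factor
    \<open>1 / \<bar>s\<bar>\<close> over \<open>f(s)\<close> and is absolutely integrable on vertical lines.
  \<close>
  define D where "D t = G (Complex 0 (\<sigma> * t)) - of_real x * G (Complex 1 (\<sigma> * t))" for t
  define D' where "D' t = of_real \<sigma> * \<i> * (f (Complex 0 (\<sigma> * t)) - of_real x * f (Complex 1 (\<sigma> * t)))" for t
  have a1: "a 1 > 0" using weakly_supermajorizedD(1)[OF maj] q by auto
  obtain L where L: "(D \<longlongrightarrow> L) at_top"
  proof -
    obtain M where M: "\<And>t. \<bar>t\<bar> \<ge> 1 \<Longrightarrow> norm (1 - (\<Prod>i=1..q. Complex (a i) t / Complex (b i) t)) \<le> M / \<bar>t\<bar>"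
      using norm_one_minus_prod_Complex_quotient_le by blast
    obtain K where K: "\<And>c t. c \<in> {0..0} \<Longrightarrow> t \<noteq> 0 \<Longrightarrow> norm (f (Complex c t)) \<le> K * \<bar>t\<bar> powr (- \<delta>)"
      using norm_f_le[OF _ n, of 0 0] a1 unfolding \<delta>_def by auto
    have "\<exists>L. (D \<longlongrightarrow> L) at_top"
    proof (rule tendsto_at_top_of_derivative_bound[OF _ _ \<delta>])
      fix t :: real assume t: "t \<ge> 1"
      have G': "((\<lambda>t. G (Complex c (\<sigma> * t))) has_vector_derivative of_real \<sigma> * \<i> * f (Complex c (\<sigma> * t))) (at t)"
        if "c > - a 1" for c
      proof -
        have "((\<lambda>t. of_real c + of_real \<sigma> * \<i> * of_real t) has_vector_derivative of_real \<sigma> * \<i>) (at t)"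
          by (auto intro!: derivative_eq_intros has_vector_derivative_real_field)
        moreover have "of_real c + of_real \<sigma> * \<i> * of_real t = Complex c (\<sigma> * t)" for t
          by (simp add: complex_eq_iff)
        ultimately have "((\<lambda>t. Complex c (\<sigma> * t)) has_vector_derivative of_real \<sigma> * \<i>) (at t)" by simp
        from field_vector_diff_chain_at[OF this G] that show ?thesis by (simp add: o_def)
      qed
      show "(D has_vector_derivative D' t) (at t)"
      proof -
        have "of_real \<sigma> * \<i> * f (Complex 0 (\<sigma> * t)) - of_real x * (of_real \<sigma> * \<i> * f (Complex 1 (\<sigma> * t))) = D' t"
          by (simp add: D'_def right_diff_distrib mult_ac)
        with has_vector_derivative_diff[OF G'[of 0] has_vector_derivative_mult_right[OF G'[of 1], of "of_real x"]] a1
        show ?thesis by (simp add: D_def[abs_def])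
      qed
      have "D' t = of_real \<sigma> * \<i> * (f (Complex 0 (\<sigma> * t)) * (1 - (\<Prod>i=1..q. Complex (a i) (\<sigma> * t) / Complex (b i) (\<sigma> * t))))"
        using f_shift[of 0 "\<sigma> * t"] a1 by (simp add: D'_def right_diff_distrib)
      then have "norm (D' t) = norm (f (Complex 0 (\<sigma> * t))) * norm (1 - (\<Prod>i=1..q. Complex (a i) (\<sigma> * t) / Complex (b i) (\<sigma> * t)))"
        using \<sigma> by (auto simp: norm_mult)
      also have "\<dots> \<le> (K * t powr (- \<delta>)) * (M / t)"
      proof (rule mult_mono)
        show "norm (f (Complex 0 (\<sigma> * t))) \<le> K * t powr (- \<delta>)"
          using K[of 0 "\<sigma> * t"] t \<sigma> by auto
        then show "0 \<le> K * t powr (- \<delta>)" by (rule order_trans[OF norm_ge_zero])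
      qed (use M[of "\<sigma> * t"] t \<sigma> in auto)
      also have "\<dots> = K * M * t powr (- \<delta> - 1)"
        using t powr_diff[of t "- \<delta>" 1] by simp
      finally show "norm (D' t) \<le> K * M * t powr (- \<delta> - 1)" .
    qed
    then show thesis using that by blast
  qed
  \<comment> \<open>\<open>D\<close> equals (1 - x) G(0 + i\<open>\<sigma>\<close>t) plus x times a
    difference that tends to 0 by \<open>close\<close>. Since x < 1, the first term can be solved
    for.\<close>
  have "((\<lambda>t. (D t - of_real x * (G (Complex 0 (\<sigma> * t)) - G (Complex 1 (\<sigma> * t)))) / (1 - of_real x))
      \<longlongrightarrow> (L - of_real x * 0) / (1 - of_real x)) at_top"
    using x a1 by (intro tendsto_divide tendsto_diff tendsto_mult_left tendsto_const L close) auto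
  moreover have "(D t - of_real x * (G (Complex 0 (\<sigma> * t)) - G (Complex 1 (\<sigma> * t)))) / (1 - of_real x)
      = G (Complex 0 (\<sigma> * t))" for t
  proof -
    have "1 - complex_of_real x \<noteq> 0" using x by (simp add: complex_eq_iff)
    then show ?thesis by (simp add: D_def field_simps)
  qed
  ultimately have lim0: "((\<lambda>t. G (Complex 0 (\<sigma> * t))) \<longlongrightarrow> L / (1 - of_real x)) at_top" by simp
  show thesis
  proof (rule that)
    show "((\<lambda>t. G (Complex c (\<sigma> * t))) \<longlongrightarrow> L / (1 - of_real x)) at_top" if "c > - a 1" for c
      using tendsto_add[OF close[of c 0] lim0] that a1 by simp
  qed
qed

lemma Min_a: "Min (a ` {1..q}) = a 1"
  using weakly_supermajorizedD(3)[OF maj, of 1] q by (intro Min_eqI) auto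

text \<open>A half-plane is convex, so \<open>f\<close> has a primitive there and the contour
  integrals are differences of its end values. The limit on the imaginary axis is exported as well,
  because the sign is determined there.\<close>

lemma has_meijer_G_via_primitive:
  obtains G \<Lambda> where "\<And>s. s \<in> halfplane \<Longrightarrow> (G has_field_derivative f s) (at s)"
    "((\<lambda>t. G (Complex 0 t) - G (Complex 0 (- t))) \<longlongrightarrow> \<Lambda>) at_top"
    "has_meijer_G q b a x (\<Lambda> / (2 * of_real pi * \<i>))"
proof -
  have opn: "open halfplane" by (rule open_halfspace_Re_gt)
  obtain G where "\<And>s. s \<in> halfplane \<Longrightarrow> (G has_field_derivative f s) (at s within halfplane)"
    using holomorphic_convex_primitive'[OF convex_halfspace_Re_gt opn f_holomorphic] by blast
  then have G: "\<And>s. s \<in> halfplane \<Longrightarrow> (G has_field_derivative f s) (at s)"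
    using at_within_open[OF _ opn] by metis
  obtain L1 where L1: "\<And>c. c > - a 1 \<Longrightarrow> ((\<lambda>t. G (Complex c (1 * t))) \<longlongrightarrow> L1) at_top"
    using primitive_ends_converge[OF G, of 1] by auto
  obtain L2 where L2: "\<And>c. c > - a 1 \<Longrightarrow> ((\<lambda>t. G (Complex c (-1 * t))) \<longlongrightarrow> L2) at_top"
    using primitive_ends_converge[OF G, of "-1"] by auto
  have lim: "((\<lambda>t. G (Complex c t) - G (Complex c (- t))) \<longlongrightarrow> L1 - L2) at_top" if "c > - a 1" for c
    using tendsto_diff[OF L1 L2] that by simp
  have "contour_integral (linepath (Complex c (- R)) (Complex c R)) f = G (Complex c R) - G (Complex c (- R))"
    if "c > - a 1" for c R
  proof (rule contour_integral_unique)
    have "path_image (linepath (Complex c (- R)) (Complex c R)) \<subseteq> halfplane"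
      using that by (auto simp: closed_segment_same_Re)
    from contour_integral_primitive[OF has_field_derivative_at_within[OF G] valid_path_linepath this]
    show "(f has_contour_integral (G (Complex c R) - G (Complex c (- R)))) (linepath (Complex c (- R)) (Complex c R))"
      by simp
  qed
  then have "has_meijer_G q b a x (1 / (2 * of_real pi * \<i>) * (L1 - L2))"
    unfolding has_meijer_G_def Min_a
    using tendsto_mult_left[OF lim, of _ "1 / (2 * of_real pi * \<i>)"] by simp
  with G lim[of 0] weakly_supermajorizedD(1)[OF maj, of 1] q show thesis
    by (intro that[of G "L1 - L2"]) auto
qed

end

lemma meijer_G_eqI:
  assumes "has_meijer_G q b a x g"
  shows "meijer_G q b a x = g"
  unfolding meijer_G_def
proof (rule the_equality[where P = "has_meijer_G q b a x", OF assms])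
  fix g' assume g': "has_meijer_G q b a x g'"
  \<comment> \<open>An admissible abscissa exists, so the two limits can be compared on one
    line.\<close>
  have "- Min (a ` {1..q}) < 1 - Min (a ` {1..q})" by simp
  with assms g' show "g' = g"
    unfolding has_meijer_G_def by (blast intro: tendsto_unique[OF trivial_limit_at_top_linorder])
qed

section \<open>Fejer means and the sign of the integral\<close>

text \<open>Integration by parts against the triangular weight turns the weighted integral into the
  Cesaro mean of the symmetric partial integrals, the integral of \<open>\<phi>\<close> over [-t, t]
  being \<open>\<Phi> t - \<Phi> (- t)\<close>.\<close>

lemma integral_Fejer_kernel:
  fixes \<Phi> \<phi> :: "real \<Rightarrow> complex"
  assumes "R > 0" and \<Phi>: "\<And>t. (\<Phi> has_vector_derivative \<phi> t) (at t)" and \<phi>: "continuous_on UNIV \<phi>"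
  shows "integral {-R..R} (\<lambda>t. of_real (1 - \<bar>t\<bar> / R) * \<phi> t)
    = of_real (1 / R) * integral {0..R} (\<lambda>t. \<Phi> t - \<Phi> (- t))"
proof -
  define w where "w t = of_real (1 - \<bar>t\<bar> / R) * \<phi> t" for t
  define v where "v t = of_real (1 / R) * (\<Phi> t - \<Phi> (- t))" for t
  have \<phi>': "continuous_on A \<phi>" "continuous_on A (\<lambda>t. \<phi> (- t))" for A
    using continuous_on_compose2[OF \<phi>, of A "\<lambda>t. - t"] continuous_on_subset[OF \<phi>]
    by (simp_all add: continuous_on_minus)
  have "continuous_on A \<Phi>" for A
    by (intro continuous_at_imp_continuous_on ballI has_vector_derivative_continuous[OF \<Phi>])
  then have v: "continuous_on A v" for A
    unfolding v_def by (intro continuous_intros continuous_on_compose2[of UNIV \<Phi> A uminus]) auto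
  have w: "continuous_on A w" "continuous_on A (\<lambda>t. w (- t))" for A
    unfolding w_def using \<open>R > 0\<close> by (auto intro!: continuous_intros \<phi>')
  have "integral {-R..R} w = integral {-R..0} w + integral {0..R} w"
    using \<open>R > 0\<close> by (intro Henstock_Kurzweil_Integration.integral_combine[symmetric] integrable_continuous_real w) auto
  also have "integral {-R..0} w = integral {0..R} (\<lambda>t. w (- t))"
    using Henstock_Kurzweil_Integration.integral_reflect_real[of 0 "- R" w] by simp
  also have "\<dots> + integral {0..R} w = integral {0..R} (\<lambda>t. w (- t) + w t)"
    by (intro integral_add[symmetric] integrable_continuous_real w)
  also have "\<dots> = integral {0..R} v"
  proof -
    \<comment> \<open>The boundary terms vanish: at \<open>R\<close> through the weight, at 0
      through the difference.\<close>
    have "((\<lambda>t. (w (- t) + w t) - v t) has_integral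
        of_real (1 - R / R) * (\<Phi> R - \<Phi> (- R)) - of_real (1 - 0 / R) * (\<Phi> 0 - \<Phi> (- 0))) {0..R}"
    proof (rule fundamental_theorem_of_calculus)
      fix t assume t: "t \<in> {0..R}"
      have "((\<lambda>t. \<Phi> (- t)) has_vector_derivative - \<phi> (- t)) (at t)"
      proof -
        have "((\<lambda>t. - t) has_vector_derivative - 1) (at t)"
          by (auto intro!: derivative_eq_intros)
        from vector_diff_chain_at[OF this \<Phi>] show ?thesis by (simp add: o_def)
      qed
      from has_vector_derivative_diff[OF \<Phi> this]
      have 1: "((\<lambda>t. \<Phi> t - \<Phi> (- t)) has_vector_derivative \<phi> t + \<phi> (- t)) (at t)" by simp
      have "((\<lambda>t. 1 - t / R) has_real_derivative - (1 / R)) (at t)"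
        using \<open>R > 0\<close> by (auto intro!: derivative_eq_intros)
      then have 2: "((\<lambda>t. of_real (1 - t / R) :: complex) has_vector_derivative of_real (- (1 / R))) (at t)"
        by (intro has_vector_derivative_of_real) (simp add: has_real_derivative_iff_has_vector_derivative)
      have "((\<lambda>t. of_real (1 - t / R) * (\<Phi> t - \<Phi> (- t))) has_vector_derivative (w (- t) + w t) - v t) (at t)"
        using has_vector_derivative_mult[OF 2 1] t by (simp add: w_def v_def algebra_simps)
      then show "((\<lambda>t. of_real (1 - t / R) * (\<Phi> t - \<Phi> (- t))) has_vector_derivative
          (w (- t) + w t) - v t) (at t within {0..R})"
        by (rule has_vector_derivative_at_within)
    qed (use \<open>R > 0\<close> in auto)
    then have "integral {0..R} (\<lambda>t. (w (- t) + w t) - v t) = 0"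
      using \<open>R > 0\<close> by (simp add: integral_unique)
    moreover have "integral {0..R} (\<lambda>t. (w (- t) + w t) - v t) = integral {0..R} (\<lambda>t. w (- t) + w t) - integral {0..R} v"
      by (intro integral_diff integrable_continuous_real continuous_intros w v)
    ultimately show ?thesis by simp
  qed
  also have "\<dots> = of_real (1 / R) * integral {0..R} (\<lambda>t. \<Phi> t - \<Phi> (- t))"
    unfolding v_def by (rule integral_mult_right)
  finally show ?thesis by (simp add: w_def)
qed

text \<open>By the preceding identity the transform is 2(1 - cos(yR)) / (R y^2) for nonzero y, and R
  for y = 0.\<close>

lemma fourier_nonneg_Fejer_kernel:
  assumes "R > 0"
  shows "fourier_nonneg R (\<lambda>t. of_real (1 - \<bar>t\<bar> / R))"
  unfolding fourier_nonneg_def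
proof (intro conjI allI)
  show "continuous_on {-R..R} (\<lambda>t. complex_of_real (1 - \<bar>t\<bar> / R))"
    using assms by (intro continuous_intros) auto
  fix y :: real
  show "integral {-R..R} (\<lambda>t. of_real (1 - \<bar>t\<bar> / R) * cis (- (y * t))) \<in> \<real>\<^sub>\<ge>\<^sub>0"
  proof -
    \<comment> \<open>An antiderivative of the character; y = 0 is separate because of the division
      by y.\<close>
    define \<Phi> where "\<Phi> t = (if y = 0 then of_real t else \<i> * cis (- (y * t)) / of_real y)" for t
    have \<Phi>: "(\<Phi> has_vector_derivative cis (- (y * t))) (at t)" for t
    proof (cases "y = 0")
      case True
      then show ?thesis
        unfolding \<Phi>_def by (auto intro!: derivative_eq_intros has_vector_derivative_real_field)
    next
      case False
      then have "((\<lambda>z. \<i> * exp (- (\<i> * of_real y * z)) / of_real y) has_field_derivative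
          exp (- (\<i> * of_real y * of_real t))) (at (of_real t))"
        by (auto intro!: derivative_eq_intros)
      from has_vector_derivative_real_field[OF this] False show ?thesis
        by (simp add: \<Phi>_def[abs_def] cis_conv_exp mult.assoc)
    qed
    have "((\<lambda>t. \<Phi> t - \<Phi> (- t)) has_integral
        of_real (if y = 0 then R\<^sup>2 else 2 * (1 - cos (y * R)) / y\<^sup>2)) {0..R}"
    proof (cases "y = 0")
      case True
      have "((\<lambda>t. 2 * t) has_integral R\<^sup>2 - 0\<^sup>2) {0..R}"
        using assms by (intro fundamental_theorem_of_calculus)
         (auto intro!: derivative_eq_intros simp flip: has_real_derivative_iff_has_vector_derivative)
      from has_integral_of_real[OF this, where 'b = complex] True show ?thesis by (simp add: \<Phi>_def)
    next
      case False
      have "((\<lambda>t. 2 * sin (y * t) / y) has_integral (- 2 * cos (y * R) / y\<^sup>2) - (- 2 * cos (y * 0) / y\<^sup>2)) {0..R}"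
        using assms False by (intro fundamental_theorem_of_calculus)
         (auto intro!: derivative_eq_intros simp: power2_eq_square simp flip: has_real_derivative_iff_has_vector_derivative)
      from has_integral_of_real[OF this, where 'b = complex] 
      have "((\<lambda>t. complex_of_real (2 * sin (y * t) / y)) has_integral of_real (2 * (1 - cos (y * R)) / y\<^sup>2)) {0..R}"
        by (simp add: diff_divide_distrib right_diff_distrib)
      moreover have "\<Phi> t - \<Phi> (- t) = of_real (2 * sin (y * t) / y)" for t
        using False by (simp add: \<Phi>_def complex_eq_iff)
      ultimately show ?thesis using False by simp
    qed
    then have "integral {0..R} (\<lambda>t. \<Phi> t - \<Phi> (- t)) = of_real (if y = 0 then R\<^sup>2 else 2 * (1 - cos (y * R)) / y\<^sup>2)"
      by (rule integral_unique)
    moreover have "integral {-R..R} (\<lambda>t. of_real (1 - \<bar>t\<bar> / R) * cis (- (y * t)))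
        = of_real (1 / R) * integral {0..R} (\<lambda>t. \<Phi> t - \<Phi> (- t))"
      using assms \<Phi> by (intro integral_Fejer_kernel) (auto intro!: continuous_intros)
    ultimately show ?thesis
      using assms by (auto intro!: nonneg_Reals_mult_I simp del: of_real_divide of_real_power of_real_mult)
  qed
qed

text \<open>L'Hospital's rule for the integral over \<open>R\<close>, applied to real and imaginary
  parts, since the rule concerns real functions.\<close>

lemma tendsto_Cesaro_mean:
  fixes w :: "real \<Rightarrow> complex"
  assumes w: "continuous_on UNIV w" and lim: "(w \<longlongrightarrow> L) at_top"
  shows "((\<lambda>R. of_real (1 / R) * integral {0..R} w) \<longlongrightarrow> L) at_top"
proof -
  have deriv: "((\<lambda>R. integral {0..R} w) has_vector_derivative w R) (at R)" if "R > 0" for R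
  proof -
    have "((\<lambda>R. integral {0..R} w) has_vector_derivative w R) (at R within {0..R + 1})"
      using that by (intro integral_has_vector_derivative continuous_on_subset[OF w]) auto
    then show ?thesis using that by (simp add: at_within_Icc_at)
  qed
  have "((\<lambda>R. p (integral {0..R} w) / R) \<longlongrightarrow> p L) at_top" if p: "bounded_linear p" for p :: "complex \<Rightarrow> real"
  proof (rule lhospital_at_top_at_top)
    show "\<forall>\<^sub>F R in at_top. ((\<lambda>R. p (integral {0..R} w)) has_real_derivative p (w R)) (at R)"
      unfolding has_real_derivative_iff_has_vector_derivative
      using eventually_gt_at_top[of 0]
      by eventually_elim (rule bounded_linear.has_vector_derivative[OF p deriv])
    show "((\<lambda>R. p (w R) / 1) \<longlongrightarrow> p L) at_top"
      using bounded_linear.tendsto[OF p lim] by simp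
  qed (auto simp: filterlim_ident)
  from this[OF bounded_linear_Re] this[OF bounded_linear_Im] show ?thesis
    by (simp add: tendsto_complex_iff)
qed

context meijer
begin

text \<open>On the imaginary axis x^(-it) is the character of frequency ln x. The integral is thus
  the transform, at y = ln x, of the Fejer weight times a positive multiplier.\<close>

lemma integral_Fejer_f_nonneg:
  assumes "R > 0"
  shows "integral {-R..R} (\<lambda>t. of_real (1 - \<bar>t\<bar> / R) * f (Complex 0 t)) \<in> \<real>\<^sub>\<ge>\<^sub>0"
proof -
  have "of_real x powr (- Complex 0 t) = cis (- (ln x * t))" for t
  proof -
    have "Complex 0 t = \<i> * of_real t" by (simp add: complex_eq_iff)
    then show ?thesis using x by (simp add: powr_def cis_conv_exp Ln_of_real mult_ac)
  qed
  then have eq: "of_real (1 - \<bar>t\<bar> / R) * f (Complex 0 t)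
      = (\<Prod>i=1..q. Gamma (Complex (a i) t) / Gamma (Complex (b i) t)) * of_real (1 - \<bar>t\<bar> / R) * cis (- (ln x * t))" for t
    by (simp add: meijer_integrand_Complex)
  show ?thesis
    using positive_multiplierD(3)[OF positive_multiplier_Gamma_ratio[OF maj] fourier_nonneg_Fejer_kernel[OF assms]]
    unfolding fourier_nonneg_def eq by blast
qed

lemma meijer_G_nonneg: "\<exists>g. has_meijer_G q b a x g \<and> g \<in> \<real>\<^sub>\<ge>\<^sub>0"
proof -
  obtain G \<Lambda> where G: "\<And>s. s \<in> halfplane \<Longrightarrow> (G has_field_derivative f s) (at s)"
    and lim: "((\<lambda>t. G (Complex 0 t) - G (Complex 0 (- t))) \<longlongrightarrow> \<Lambda>) at_top"
    and g: "has_meijer_G q b a x (\<Lambda> / (2 * of_real pi * \<i>))"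
    by (rule has_meijer_G_via_primitive) (rule that, blast+)
  have a1: "a 1 > 0" using weakly_supermajorizedD(1)[OF maj] q by auto
  \<comment> \<open>The factor -i cancels the i from ds = i dt, making \<open>\<Phi>\<close> a
    primitive in the real variable \<open>t\<close>.\<close>
  define \<Phi> where "\<Phi> t = - \<i> * G (Complex 0 t)" for t
  have \<Phi>: "(\<Phi> has_vector_derivative f (Complex 0 t)) (at t)" for t
  proof -
    have "((\<lambda>t. \<i> * of_real t) has_vector_derivative \<i>) (at t)"
      by (auto intro!: derivative_eq_intros has_vector_derivative_real_field)
    moreover have "\<i> * of_real t = Complex 0 t" for t by (simp add: complex_eq_iff)
    ultimately have "(Complex 0 has_vector_derivative \<i>) (at t)" by simp
    from has_vector_derivative_mult_right[OF field_vector_diff_chain_at[OF this G], of "- \<i>"] a1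
    show ?thesis by (simp add: o_def \<Phi>_def[abs_def])
  qed
  have cont_f: "continuous_on UNIV (\<lambda>t. f (Complex 0 t))"
    using a1 by (intro continuous_on_compose2[OF holomorphic_on_imp_continuous_on[OF f_holomorphic]] continuous_intros) auto
  have cont_\<Phi>: "continuous_on UNIV \<Phi>"
    by (intro continuous_at_imp_continuous_on ballI has_vector_derivative_continuous[OF \<Phi>])
  have "((\<lambda>R. of_real (1 / R) * integral {0..R} (\<lambda>t. \<Phi> t - \<Phi> (- t))) \<longlongrightarrow> - \<i> * \<Lambda>) at_top"
  proof (rule tendsto_Cesaro_mean)
    show "continuous_on UNIV (\<lambda>t. \<Phi> t - \<Phi> (- t))"
      by (intro continuous_intros cont_\<Phi> continuous_on_compose2[OF cont_\<Phi>]) auto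
    show "((\<lambda>t. \<Phi> t - \<Phi> (- t)) \<longlongrightarrow> - \<i> * \<Lambda>) at_top"
      using tendsto_mult_left[OF lim, of "- \<i>"] by (simp add: \<Phi>_def algebra_simps)
  qed
  moreover have "\<forall>\<^sub>F R in at_top. of_real (1 / R) * integral {0..R} (\<lambda>t. \<Phi> t - \<Phi> (- t)) \<in> \<real>\<^sub>\<ge>\<^sub>0"
    using eventually_gt_at_top[of 0]
  proof eventually_elim
    fix R :: real assume "0 < R"
    from integral_Fejer_f_nonneg[OF this]
    show "of_real (1 / R) * integral {0..R} (\<lambda>t. \<Phi> t - \<Phi> (- t)) \<in> \<real>\<^sub>\<ge>\<^sub>0"
      unfolding integral_Fejer_kernel[OF \<open>0 < R\<close> \<Phi> cont_f] .
  qed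
  ultimately have "- \<i> * \<Lambda> \<in> \<real>\<^sub>\<ge>\<^sub>0"
    by (rule Lim_in_closed_set[OF closed_nonneg_Reals_complex _ trivial_limit_at_top_linorder, rotated])
  then have "of_real (1 / (2 * pi)) * (- \<i> * \<Lambda>) \<in> \<real>\<^sub>\<ge>\<^sub>0"
    by (rule nonneg_Reals_mult_I[rotated]) (simp del: of_real_divide)
  also have "of_real (1 / (2 * pi)) * (- \<i> * \<Lambda>) = \<Lambda> / (2 * of_real pi * \<i>)"
    by (simp add: field_simps)
  finally show ?thesis using g by blast
qed

end

text \<open>As \<open>meijer_G\<close> is a definite description, the first conjunct certifies that
  the integral really converges to this value on every admissible line.\<close>

theorem lemma2:
  fixes q :: nat and a b :: "nat \<Rightarrow> real" and s :: real
  assumes "q \<ge> 1"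
    and "weakly_supermajorized q b a"
    and "\<not> majorized q b a"
    and "0 < s" and "s < 1"
  shows "has_meijer_G q b a s (meijer_G q b a s) \<and> meijer_G q b a s \<in> \<real>\<^sub>\<ge>\<^sub>0"
proof -
  have "(\<Sum>i=1..q. b i - a i) \<noteq> 0"
    using assms by (auto simp: majorized_def)
  moreover have "(\<Sum>i=1..q. b i - a i) \<ge> 0"
    using weakly_supermajorizedD(5)[OF assms(2), of q] assms(1) by (simp add: sum_subtractf)
  ultimately interpret meijer q a b s
    using assms by unfold_locales auto
  obtain g where "has_meijer_G q b a s g" "g \<in> \<real>\<^sub>\<ge>\<^sub>0"
    using meijer_G_nonneg by blast
  then show ?thesis by (simp add: meijer_G_eqI)
qed

end
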